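(* Let $N\in\mathbb{N}$, and suppose $a\in\mathbb{R}$, $a_{jd}\in\mathbb{R}$ for $1\le j\le N$ (not all zero), and $h>0$. Let $$\Delta(s)=s-a-\sum_{j=1}^{N}a_{jd}e^{-jsh}$$ and let $S_n$, $n\in\mathbb{Z}$, be the roots of $\Delta(s)=0$. Then for any $s\in\mathbb{C}$, $$\frac{1}{\Delta(s)}=\frac{1}{s-a-\sum_{j=1}^{N}a_{jd}e^{-jsh}}=\sum_{n=-\infty}^{\infty}\frac{C_n}{s-S_n},$$ where $$C_n=\frac{1}{1+\sum_{j=1}^{N}j\,a_{jd}\,h\,e^{-jS_nh}},\qquad S_n=\frac1h\,W_k\!\left(\sum_{j=1}^{N}a_{jd}\,h\,e^{-jah}\,e^{-(j-1)(S_n-a)h}\right)+a,$$ and $W_k$ is the branch to which $S_n$ belongs.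
   Context: $W_k$ ($k\in\mathbb{Z}$) denotes the $k$-th branch of the Lambert W function, which satisfies $W(z)e^{W(z)}=z$. The roots are numbered so that $S_0$ has the largest real part; if $S_0$ is real then $S_{-n}=\overline{S_n}$ for $n>0$, and otherwise $S_{-(n+1)}=\overline{S_n}$ for $n\ge 0$.
   Formalization: The formal statement assumes that the denominator of every C_n is nonzero (all roots S_n are simple), since otherwise C_n is undefined, and it asserts the expansion only for s with Δ(s) ≠ 0. *)

theory Defs
  imports "HOL-Analysis.Analysis"
begin

definition char_fun :: "nat \<Rightarrow> real \<Rightarrow> (nat \<Rightarrow> real) \<Rightarrow> real \<Rightarrow> complex \<Rightarrow> complex" where
  "char_fun N a ad h s =
     s - of_real a - (\<Sum>j=1..N. of_real (ad j) * exp (- of_nat j * s * of_real h))"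

text \<open>
  Range of the k-th branch of the Lambert W function, with the standard branch cuts of
  Corless, Gonnet, Hare, Jeffrey and Knuth. The number Im w + Arg w is an argument of w * exp w,
  so the ranges are separated by the curves on which Im w + Arg w is an odd multiple of pi, that is
  by the curves -\<eta> cot \<eta> + i \<eta>; each such curve belongs to the branch below it. The one
  exception is the half-line from -1 to minus infinity, where Im w + Arg w = pi: it separates the
  branches 1 and -1 and is assigned to branch -1. The point -1 itself is the value at -1/e of both
  branch 0 and branch -1. Since Arg 0 = 0, the point 0 lies in branch 0 only.
\<close>

definition lambertW_range :: "int \<Rightarrow> complex set" where
  "lambertW_range k =
     (let B = {w. (2 * of_int k - 1) * pi < Im w + Arg w \<and> Im w + Arg w \<le> (2 * of_int k + 1) * pi}
      in if k = 0 then B - of_real ` {..< - 1}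
         else if k = - 1 then B \<union> of_real ` {.. - 1}
         else B)"

text \<open>
  For k \<noteq> 0 there is no value at 0, and the description below is then unspecified.
\<close>

definition lambertW :: "int \<Rightarrow> complex \<Rightarrow> complex" where
  "lambertW k z = (THE w. w \<in> lambertW_range k \<and> w * exp w = z)"

end

theory Submission
  imports Defs "HOL-Complex_Analysis.Complex_Analysis" "HOL-Real_Asymp.Real_Asymp"
begin

text \<open>
  Write \<open>\<Delta> s = s - a - P (exp (- s h))\<close>, where \<open>P\<close> is a real polynomial without constant term, and
  let \<open>M\<close> be its degree.

  The expansion of \<open>1 / \<Delta>\<close> is Cauchy's argument for partial fractions. On the boundaries of suitable
  squares with half side \<open>Y\<^sub>n \<rightarrow> \<infinity>\<close> one has \<open>\<bar>\<Delta> z\<bar> \<ge> Y\<^sub>n / 2\<close>, so the integral of \<open>1 / (\<Delta> z (z - s))\<close>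
  along them is \<open>O(1 / Y\<^sub>n)\<close>. By the residue theorem it is \<open>2 \<pi> \<i>\<close> times the difference of \<open>1 / \<Delta> s\<close> and
  the sum of the terms whose root lies inside the square (\<open>partial_fractions_squares\<close>). The lower
  bound (\<open>\<Delta>_lower_squares\<close>) holds because far to the left the exponential of order \<open>M\<close> dominates,
  because elsewhere \<open>s\<close> dominates, and because on the horizontal sides, which cannot avoid the region
  where the two balance, \<open>Y\<^sub>n\<close> is chosen so that the leading exponential is purely imaginary and adds
  to \<open>Im s\<close> instead of cancelling it.

  The sum is unordered, so absolute convergence is needed as well. All but finitely many roots lie in
  a left half plane \<open>Re s \<le> - X\<close> and off the real axis. There the equation \<open>\<Delta> s = 0\<close> can be put in
  logarithmic form: \<open>\<phi> s = M h s + Ln (s - a) - Ln (1 + E s)\<close> is a logarithm of the leading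
  coefficient at each root. Since \<open>\<phi>'\<close> is close to \<open>M h\<close>, the function \<open>\<phi>\<close> is injective in each of the two
  quadrants, so distinct roots belong to distinct multiples of \<open>2 \<pi> \<i>\<close>; as \<open>Im (\<phi> s)\<close> grows
  at most linearly, \<open>1 / \<bar>S\<^sub>n - a\<bar>\<^sup>2\<close> is summable over the roots. Finally
  \<open>\<Delta>' (S\<^sub>n) = (S\<^sub>n - a) \<phi>' (S\<^sub>n)\<close>, so the terms of the expansion are of this order
  (\<open>summable_roots\<close>).

  The formula for the roots is an identity: \<open>w = (S\<^sub>n - a) h\<close> satisfies \<open>w exp w = z\<close>, where \<open>z\<close> is the
  argument of the Lambert function in the statement. What has to be shown is that the branches are well defined, that is,
  that \<open>w exp w\<close> is injective on the range of each branch (\<open>inj_on_lambertW_range\<close>). The logarithm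
  \<open>w + Ln w\<close> of \<open>w exp w\<close> has derivative \<open>1 + 1 / w\<close>, whose imaginary part has constant sign in the upper
  and in the lower half plane, and this forces injectivity there. The same principle
  (\<open>neq_if_deriv_in_half_plane\<close>) gives the injectivity of \<open>\<phi>\<close>.
\<close>

section \<open>Branches of the Lambert W function\<close>

text \<open>
  The Noshiro--Warschawski criterion: the difference quotient of \<open>f\<close> is an average of values of \<open>f'\<close>,
  which stay in an open half plane with \<open>0\<close> on its boundary. Only the open segment is constrained, so the end points may lie on
  the boundary of the region where \<open>f'\<close> is controlled.
\<close>

lemma neq_if_deriv_in_half_plane:
  fixes f f' :: "complex \<Rightarrow> complex"
  assumes "a \<noteq> b" and cont: "continuous_on (closed_segment a b) f"
    and deriv: "\<And>z. z \<in> open_segment a b \<Longrightarrow> (f has_field_derivative f' z) (at z)"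
    and half_plane: "\<And>z. z \<in> open_segment a b \<Longrightarrow> Re (u * f' z) > 0"
  shows "f a \<noteq> f b"
proof -
  define d where "d = b - a"
  have d: "d \<noteq> 0" using \<open>a \<noteq> b\<close> by (simp add: d_def)
  define c where "c t = linepath a b t" for t
  have open_seg: "c t \<in> open_segment a b" if "0 < t" "t < 1" for t
    using that \<open>a \<noteq> b\<close> by (auto simp: in_segment c_def linepath_def)
  define g where "g t = Re (u * f (c t) / d)" for t
  have "g 0 < g 1"
  proof (rule DERIV_pos_imp_increasing_open[of 0 1 g])
    fix t :: real assume "0 < t" "t < 1"
    note t = open_seg[OF this]
    have "(c has_vector_derivative d) (at t)"
      unfolding c_def d_def by (rule has_vector_derivative_linepath_within)
    moreover have "((\<lambda>z. u * f z / d) has_field_derivative u * f' (c t) / d) (at (c t))"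
      using d by (auto intro!: derivative_eq_intros deriv[OF t])
    ultimately have "((\<lambda>t. u * f (c t) / d) has_vector_derivative d * (u * f' (c t) / d)) (at t)"
      unfolding o_def[symmetric, of "\<lambda>z. u * f z / d" c]
      by (rule field_vector_diff_chain_at)
    hence "((\<lambda>t. u * f (c t) / d) has_vector_derivative u * f' (c t)) (at t)"
      using d by simp
    hence "(g has_vector_derivative Re (u * f' (c t))) (at t)"
      unfolding g_def by (rule bounded_linear.has_vector_derivative[OF bounded_linear_Re])
    hence "DERIV g t :> Re (u * f' (c t))"
      by (simp add: has_real_derivative_iff_has_vector_derivative)
    thus "\<exists>y. DERIV g t :> y \<and> y > 0" using half_plane[OF t] by blast
  next
    have "continuous_on {0..1} (\<lambda>t. f (c t))"
    proof (rule continuous_on_compose2[OF cont])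
      show "continuous_on {0..1} c" unfolding c_def by (intro continuous_intros)
      show "c ` {0..1} \<subseteq> closed_segment a b"
        by (simp add: c_def linepath_image_01)
    qed
    thus "continuous_on {0..1} g"
      unfolding g_def using d by (intro continuous_intros) auto
  qed auto
  thus ?thesis by (auto simp: g_def c_def linepath_def)
qed

text \<open>
  The derivative \<open>1 + 1 / w\<close> of \<open>w + Ln w\<close> has negative imaginary part in the upper half plane. One of
  the points may lie on the negative real axis, where the standard logarithm is discontinuous;
  it is therefore replaced by \<open>Ln (- \<i> w)\<close>, which differs by a constant and is continuous on the
  closed half plane without \<open>0\<close>.
\<close>

lemma add_Ln_inj_upper_half_plane:
  assumes w: "w \<noteq> 0" "Im w \<ge> 0" and w': "w' \<noteq> 0" "Im w' \<ge> 0"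
    and pos: "Im w > 0 \<or> Im w' > 0"
    and eq: "w + Ln w = w' + Ln w'"
  shows "w = w'"
proof (rule ccontr)
  assume neq: "w \<noteq> w'"
  have Im_pos: "Im z > 0" if z: "z \<in> open_segment w w'" for z
  proof -
    obtain u where u: "0 < u" "u < 1" "z = (1 - u) *\<^sub>R w + u *\<^sub>R w'"
      using z by (auto simp: in_segment)
    hence "(1 - u) * Im w \<ge> 0" "u * Im w' \<ge> 0" "(1 - u) * Im w > 0 \<or> u * Im w' > 0"
      using w w' pos by auto
    thus ?thesis using u(3) by auto
  qed
  have segment: "z \<noteq> 0 \<and> Im z \<ge> 0" if "z \<in> closed_segment w w'" for z
  proof (cases "z = w \<or> z = w'")
    case False
    hence "Im z > 0" using that by (intro Im_pos) (simp add: open_segment_def)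
    thus ?thesis by auto
  qed (use w w' in auto)
  have off_cut: "- \<i> * z \<notin> \<real>\<^sub>\<le>\<^sub>0" if "z \<in> closed_segment w w'" for z
    using segment[OF that] by (auto simp: complex_nonpos_Reals_iff complex_eq_iff)
  have "w + Ln (- \<i> * w) \<noteq> w' + Ln (- \<i> * w')"
  proof (rule neq_if_deriv_in_half_plane[of w w' "\<lambda>z. z + Ln (- \<i> * z)" "\<lambda>z. 1 + 1 / z" \<i>])
    show "continuous_on (closed_segment w w') (\<lambda>z. z + Ln (- \<i> * z))"
      using off_cut by (intro continuous_intros) auto
    fix z assume z: "z \<in> open_segment w w'"
    hence "z \<in> closed_segment w w'" using segment_open_subset_closed by blast
    thus "((\<lambda>z. z + Ln (- \<i> * z)) has_field_derivative 1 + 1 / z) (at z)"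
      using off_cut[of z] segment[of z] by (auto intro!: derivative_eq_intros simp: field_simps)
    show "Re (\<i> * (1 + 1 / z)) > 0"
    proof -
      have "(Re z)\<^sup>2 + (Im z)\<^sup>2 > 0" using Im_pos[OF z] by (simp add: sum_power2_gt_zero_iff)
      thus ?thesis using Im_pos[OF z] by (simp add: Im_divide)
    qed
  qed (fact neq)
  moreover have rot: "Ln (- \<i> * z) = Ln z - \<i> * pi / 2" if "z \<noteq> 0" "Im z \<ge> 0" for z
  proof -
    have "0 \<le> Im (Ln z)" "Im (Ln z) \<le> pi" using Im_Ln_pos_le[of z] that by auto
    hence "- pi < Im (Ln z) - pi / 2" "Im (Ln z) - pi / 2 \<le> pi" using pi_gt_zero by linarith+
    thus ?thesis using Ln_times_simple[of "-\<i>" z] that by simp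
  qed
  have "w + Ln (- \<i> * w) = w' + Ln (- \<i> * w')"
    unfolding rot[OF w] rot[OF w'] using eq by simp
  ultimately show False by simp
qed

lemma Im_add_Arg_sign:
  "Im w > 0 \<Longrightarrow> Im w + Arg w > 0" "Im w < 0 \<Longrightarrow> Im w + Arg w < 0"
  using Arg_pos_iff[of w] Arg_neg_iff[of w] by simp_all

text \<open>
  The sign of \<open>Im w + Arg w\<close> tells the closed upper half plane from the positive real axis and the
  open lower half plane. The exception for two negative reals is genuine, since \<open>x + ln \<bar>x\<bar>\<close> is not
  monotone for \<open>x < 0\<close>.
\<close>

lemma add_Ln_inj:
  assumes nz: "w \<noteq> 0" "w' \<noteq> 0" and eq: "w + Ln w = w' + Ln w'"
  shows "w = w' \<or> (Im w = 0 \<and> Im w' = 0 \<and> Re w < 0 \<and> Re w' < 0)"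
proof -
  have theta: "Im w + Arg w = Im w' + Arg w'"
    using arg_cong[OF eq, of Im] nz by (simp add: Arg_eq_Im_Ln)
  have real: "Im v = 0 \<Longrightarrow> Im v + Arg v = (if Re v < 0 then pi else 0)" for v
    by (simp add: Arg_eq_pi Arg_eq_0 complex_is_Real_iff)
  consider "Im w + Arg w > 0" | "Im w + Arg w = 0" | "Im w + Arg w < 0" by linarith
  thus ?thesis
  proof cases
    case 1
    hence "Im w \<ge> 0" "Im w' \<ge> 0"
      using Im_add_Arg_sign(2)[of w] Im_add_Arg_sign(2)[of w'] theta by force+
    thus ?thesis
      using add_Ln_inj_upper_half_plane[OF nz(1) _ nz(2) _ _ eq] real[of w] real[of w'] 1 theta
      by (smt (verit))
  next
    case 2
    hence im: "Im w = 0" "Im w' = 0"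
      using Im_add_Arg_sign[of w] Im_add_Arg_sign[of w'] theta by force+
    hence re: "Re w > 0" "Re w' > 0"
      using real[of w] real[of w'] 2 theta nz pi_gt_zero
      by (auto simp: complex_eq_iff split: if_splits)
    have "Re w + ln (Re w) = Re w' + ln (Re w')"
      using arg_cong[OF eq, of Re] nz im re by (simp add: cmod_eq_Re)
    moreover have "\<not> x < y" if "x > 0" "y > 0" "x + ln x = y + ln y" for x y :: real
      using that ln_less_cancel_iff[of x y] by linarith
    ultimately have "Re w = Re w'"
      using re by (metis linorder_neqE_linordered_idom)
    thus ?thesis using im by (simp add: complex_eq_iff)
  next
    case 3
    hence "Im w < 0" "Im w' < 0"
      using Im_add_Arg_sign(1)[of w] Im_add_Arg_sign(1)[of w'] theta real[of w] real[of w'] pi_gt_zero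
      by (smt (verit))+
    hence off: "w \<notin> \<real>\<^sub>\<le>\<^sub>0" "w' \<notin> \<real>\<^sub>\<le>\<^sub>0"
      by (simp_all add: complex_nonpos_Reals_iff)
    have "cnj w + Ln (cnj w) = cnj w' + Ln (cnj w')"
      using arg_cong[OF eq, of cnj] by (simp only: complex_cnj_add cnj_Ln[OF off(1)] cnj_Ln[OF off(2)])
    from add_Ln_inj_upper_half_plane[OF _ _ _ _ _ this]
    have "cnj w = cnj w'"
      using nz \<open>Im w < 0\<close> \<open>Im w' < 0\<close> by simp
    thus ?thesis by simp
  qed
qed

lemma mult_exp_strict_mono:
  fixes x y :: real
  assumes "-1 \<le> x" "x < y" shows "x * exp x < y * exp y"
proof (rule DERIV_pos_imp_increasing_open[OF \<open>x < y\<close>])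
  fix t assume t: "x < t" "t < y"
  have "((\<lambda>x. x * exp x) has_real_derivative (1 + t) * exp t) (at t)"
    by (auto intro!: derivative_eq_intros simp: algebra_simps)
  thus "\<exists>D. ((\<lambda>x. x * exp x) has_real_derivative D) (at t) \<and> D > 0"
    using t assms by (intro exI[of _ "(1 + t) * exp t"]) auto
qed (auto intro!: continuous_intros)

lemma mult_exp_strict_antimono:
  fixes x y :: real
  assumes "y \<le> -1" "x < y" shows "x * exp x > y * exp y"
proof (rule DERIV_neg_imp_decreasing_open[OF \<open>x < y\<close>])
  fix t assume t: "x < t" "t < y"
  have "((\<lambda>x. x * exp x) has_real_derivative (1 + t) * exp t) (at t)"
    by (auto intro!: derivative_eq_intros simp: algebra_simps)
  thus "\<exists>D. ((\<lambda>x. x * exp x) has_real_derivative D) (at t) \<and> D < 0"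
    using t assms by (intro exI[of _ "(1 + t) * exp t"]) (auto simp: mult_less_0_iff)
qed (auto intro!: continuous_intros)

lemma lambertW_range_iff:
  "w \<in> lambertW_range k \<longleftrightarrow>
     (if Im w = 0 \<and> Re w < -1 then k = -1
      else ((2 * of_int k - 1) * pi < Im w + Arg w \<and> Im w + Arg w \<le> (2 * of_int k + 1) * pi)
           \<or> (k = -1 \<and> w = -1))"
proof -
  have real: "w \<in> complex_of_real ` A \<longleftrightarrow> Im w = 0 \<and> Re w \<in> A" for A
    by (auto simp: image_iff complex_eq_iff)
  have arg: "Arg w = pi" if "Im w = 0" "Re w < -1"
    using that by (simp add: Arg_eq_pi)
  have "k = 0" if "(2 * of_int k - 1) * pi < pi" "pi \<le> (2 * of_int k + 1) * pi"
  proof -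
    have "(2 * of_int k - 1 :: real) < 1" "1 \<le> (2 * of_int k + 1 :: real)"
      using that pi_gt_zero by (simp_all add: mult_less_cancel_right2 mult_le_cancel_right1)
    thus ?thesis by linarith
  qed
  thus ?thesis
    using arg by (auto simp: lambertW_range_def Let_def real complex_eq_iff)
qed

text \<open>
  If \<open>w exp w = w' exp w'\<close>, then \<open>w + Ln w\<close> and \<open>w' + Ln w'\<close> differ by a multiple of \<open>2 \<pi> \<i>\<close>. Inside one
  strip \<open>(2 k - 1) \<pi> < \<theta> \<le> (2 k + 1) \<pi>\<close> for \<open>\<theta> = Im w + Arg w\<close> the multiple vanishes. The half-line attached
  to branch \<open>-1\<close> has \<open>\<theta> = \<pi>\<close> and lies outside that branch's strip; it could only collide with the
  boundary curve \<open>\<theta> = - \<pi>\<close>, whose complex conjugate has \<open>\<theta> = \<pi>\<close>, so that the injectivity of \<open>w + Ln w\<close>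
  on the closed upper half plane excludes this. On the negative real axis the
  critical point \<open>-1\<close> of \<open>x exp x\<close> separates the branches \<open>0\<close> and \<open>-1\<close>.
\<close>

lemma inj_on_lambertW_range: "inj_on (\<lambda>w. w * exp w) (lambertW_range k)"
proof (rule inj_onI)
  fix w w' assume w: "w \<in> lambertW_range k" and w': "w' \<in> lambertW_range k"
    and eq: "w * exp w = w' * exp w'"
  define \<theta> where "\<theta> v = Im v + Arg v" for v
  show "w = w'"
  proof (cases "w = 0 \<or> w' = 0")
    case True
    thus ?thesis using eq by auto
  next
    case False
    hence nz: "w \<noteq> 0" "w' \<noteq> 0" by auto
    have real: "Im v = 0 \<Longrightarrow> \<theta> v = (if Re v < 0 then pi else 0)" for v
      by (simp add: \<theta>_def Arg_eq_pi Arg_eq_0 complex_is_Real_iff)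
    have "exp (w + Ln w) = exp (w' + Ln w')"
      using eq nz by (simp add: exp_add mult.commute)
    then obtain m :: int where m: "w + Ln w = w' + Ln w' + of_int (2 * m) * pi * \<i>"
      by (auto simp: exp_eq)
    have Re_eq: "Re (w + Ln w) = Re (w' + Ln w')" using m by simp
    have Im_eq: "\<theta> w = \<theta> w' + 2 * m * pi"
      using arg_cong[OF m, of Im] nz by (simp add: \<theta>_def Arg_eq_Im_Ln)
    have "\<theta> v = Im (v + Ln v)" if "v \<noteq> 0" for v using that by (simp add: \<theta>_def Arg_eq_Im_Ln)
    hence same: "w = w' \<or> (Im w = 0 \<and> Im w' = 0 \<and> Re w < 0 \<and> Re w' < 0)" if "\<theta> w = \<theta> w'"
      using that nz Re_eq by (intro add_Ln_inj) (auto simp: complex_eq_iff)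
    have neg_real: "\<theta> v \<noteq> - pi"
      if *: "u \<noteq> 0" "v \<noteq> 0" "Im u = 0" "Re u < 0" "Re (u + Ln u) = Re (v + Ln v)" for u v
    proof
      assume v: "\<theta> v = - pi"
      hence "Im v < 0" using real[of v] Im_add_Arg_sign(1)[of v] pi_gt_zero
        unfolding \<theta>_def by (smt (verit))
      moreover from this have "Ln (cnj v) = cnj (Ln v)"
        by (intro cnj_Ln[symmetric]) (auto simp: complex_nonpos_Reals_iff)
      moreover have "Im (u + Ln u) = pi"
        using real[of u] * by (simp add: \<theta>_def Arg_eq_Im_Ln)
      ultimately have "u + Ln u = cnj v + Ln (cnj v)"
        using * v by (auto simp: complex_eq_iff \<theta>_def Arg_eq_Im_Ln)
      from add_Ln_inj_upper_half_plane[OF _ _ _ _ _ this]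
      have "u = cnj v"
        using * \<open>Im v < 0\<close> by simp
      thus False using \<open>Im v < 0\<close> * by auto
    qed
    have range: "if Im v = 0 \<and> Re v \<le> -1 \<and> k = -1 then \<theta> v = pi
        else (2 * of_int k - 1) * pi < \<theta> v \<and> \<theta> v \<le> (2 * of_int k + 1) * pi \<and> \<not> (Im v = 0 \<and> Re v < -1)"
      if "v \<in> lambertW_range k" for v
      using that real[of v] unfolding lambertW_range_iff \<theta>_def by (auto split: if_splits)
    have both_real: "w = w'" if "Im w = 0" "Im w' = 0" "Re w < 0" "Re w' < 0"
    proof -
      have "of_real (Re w * exp (Re w)) = w * exp w" "of_real (Re w' * exp (Re w')) = w' * exp w'"
        using that by (simp_all add: complex_eq_iff Re_exp Im_exp)
      hence "Re w * exp (Re w) = Re w' * exp (Re w')"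
        using eq by (metis of_real_eq_iff)
      moreover have "(Re w \<ge> -1 \<and> Re w' \<ge> -1) \<or> (Re w \<le> -1 \<and> Re w' \<le> -1)"
        using range[OF w] range[OF w'] that by (auto simp: real)
      ultimately have "Re w = Re w'"
        using mult_exp_strict_mono[of "Re w" "Re w'"] mult_exp_strict_mono[of "Re w'" "Re w"]
          mult_exp_strict_antimono[of "Re w" "Re w'"] mult_exp_strict_antimono[of "Re w'" "Re w"]
        by linarith
      thus ?thesis using that by (simp add: complex_eq_iff)
    qed
    have "\<theta> w = \<theta> w' \<or> (Im w = 0 \<and> Re w < 0 \<and> \<theta> w' = -pi) \<or> (Im w' = 0 \<and> Re w' < 0 \<and> \<theta> w = -pi)"
    proof -
      \<comment> \<open>In units of \<open>2 \<pi>\<close>, the strip of branch \<open>k\<close> is \<open>k - 1 < t \<le> k\<close> and the half-line has \<open>t = 0\<close>.\<close>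
      define t where "t v = (\<theta> v / pi - 1) / 2" for v
      have \<theta>_t: "\<theta> v = (2 * t v + 1) * pi" for v by (simp add: t_def field_simps)
      have t: "if Im v = 0 \<and> Re v \<le> -1 \<and> k = -1 then t v = 0 else k - 1 < t v \<and> t v \<le> k"
        if "v \<in> lambertW_range k" for v
        using range[OF that] pi_gt_zero unfolding \<theta>_t by (auto split: if_splits)
      have "2 * (t w - t w' - m) * pi = 0"
        using Im_eq unfolding \<theta>_t by (simp add: algebra_simps)
      hence tm: "t w = t w' + m" by simp
      have "t w = t w' \<or> (Im w = 0 \<and> Re w \<le> -1 \<and> t w' = -1) \<or> (Im w' = 0 \<and> Re w' \<le> -1 \<and> t w = -1)"
      proof -
        have int: "x = -1" if "x = of_int i" "-2 < x" "x \<le> -1" for x :: real and i :: int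
        proof -
          have "i = -1" using that by linarith
          thus ?thesis using that(1) by simp
        qed
        have "\<bar>m\<bar> < 1" if "k - 1 < t w" "t w \<le> k" "k - 1 < t w'" "t w' \<le> k"
          using that tm by linarith
        moreover have "t w' = -1" if "t w = 0" "-2 < t w'" "t w' \<le> -1"
          using int[of "t w'" "-m"] that tm by simp
        moreover have "t w = -1" if "t w' = 0" "-2 < t w" "t w \<le> -1"
          using int[of "t w" m] that tm by simp
        ultimately show ?thesis
          using t[OF w] t[OF w'] tm by (auto split: if_splits)
      qed
      thus ?thesis unfolding \<theta>_t by auto
    qed
    thus ?thesis
      using same both_real neg_real[OF nz] neg_real[OF nz(2,1)] Re_eq by metis
  qed
qed

lemma lambertW_range_exists: "\<exists>k. w \<in> lambertW_range k"
proof (cases "Im w = 0 \<and> Re w < -1")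
  case False
  define k where "k = \<lceil>(Im w + Arg w - pi) / (2 * pi)\<rceil>"
  have "of_int k - 1 < (Im w + Arg w - pi) / (2 * pi)" "(Im w + Arg w - pi) / (2 * pi) \<le> of_int k"
    unfolding k_def by linarith+
  hence "(2 * of_int k - 1) * pi < Im w + Arg w" "Im w + Arg w \<le> (2 * of_int k + 1) * pi"
    using pi_gt_zero by (simp_all add: field_simps)
  thus ?thesis using False unfolding lambertW_range_iff by auto
qed (auto simp: lambertW_range_iff)

lemma lambertW_eqI:
  assumes "w \<in> lambertW_range k" "w * exp w = z"
  shows "lambertW k z = w"
  unfolding lambertW_def
  using assms inj_on_lambertW_range[of k] by (intro the_equality) (auto dest: inj_onD)

section \<open>Partial fractions from integrals over squares\<close>

lemma finite_zeros_cball: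
  fixes f :: "complex \<Rightarrow> complex"
  assumes "f holomorphic_on UNIV" "f s \<noteq> 0"
  shows "finite {z. norm z \<le> R \<and> f z = 0}"
proof (cases "{z. f z = 0} = {}")
  case False
  hence "\<not> f constant_on UNIV" using assms(2) unfolding constant_on_def by fastforce
  hence "finite {z \<in> cball 0 R. f z = 0}"
    using assms(1) by (intro holomorphic_compact_finite_zeros[of f UNIV]) auto
  thus ?thesis by (simp add: cball_def)
next
  case True
  hence empty: "{z. norm z \<le> R \<and> f z = 0} = {}" by auto
  show ?thesis unfolding empty by simp
qed

lemma residue_at_simple_zero:
  assumes f: "f holomorphic_on UNIV" and p: "f p = 0" "deriv f p \<noteq> 0" and s: "s \<noteq> p"
  shows "residue (\<lambda>z. 1 / (f z * (z - s))) p = - (1 / (deriv f p * (s - p)))"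
proof -
  have deriv: "(f has_field_derivative deriv f p) (at p)"
    using f holomorphic_derivI[of f UNIV p] by simp
  hence lim: "((\<lambda>z. (f z - f p) / (z - p)) \<longlongrightarrow> deriv f p) (at p)"
    by (simp add: has_field_derivative_iff)
  have "eventually (\<lambda>z. f z \<noteq> 0) (at p)"
    using tendsto_imp_eventually_ne[OF lim p(2)] by eventually_elim (use p in auto)
  hence "eventually (\<lambda>z. f z \<noteq> 0 \<and> z \<noteq> s) (at p)"
    using s by (intro eventually_conj eventually_neq_at_within) auto
  then obtain U where U: "open U" "p \<in> U" "\<And>z. z \<in> U \<Longrightarrow> z \<noteq> p \<Longrightarrow> f z \<noteq> 0 \<and> z \<noteq> s"
    unfolding eventually_at_topological by blast
  show ?thesis
  proof (rule residue_simple')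
    show "(\<lambda>z. 1 / (f z * (z - s))) holomorphic_on U - {p}"
      using U(3) holomorphic_on_subset[OF f] by (auto intro!: holomorphic_intros)
    have "((\<lambda>z. inverse ((f z - f p) / (z - p)) / (z - s)) \<longlongrightarrow> inverse (deriv f p) / (p - s)) (at p)"
      using p s by (intro tendsto_intros lim) auto
    also have "inverse (deriv f p) / (p - s) = - (1 / (deriv f p * (s - p)))"
      using p s by (simp add: field_simps)
    also have "(\<lambda>z. inverse ((f z - f p) / (z - p)) / (z - s)) = (\<lambda>z. 1 / (f z * (z - s)) * (z - p))"
      by (auto simp: p field_simps)
    finally show "((\<lambda>z. 1 / (f z * (z - s)) * (z - p)) \<longlongrightarrow> - (1 / (deriv f p * (s - p)))) (at p)" .
  qed (use U in auto)
qed

lemma contour_integral_rectpath_bound: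
  assumes "continuous_on (path_image (rectpath a b)) f" "Re a \<le> Re b" "Im a \<le> Im b" "B \<ge> 0"
    and "\<And>z. z \<in> path_image (rectpath a b) \<Longrightarrow> norm (f z) \<le> B"
  shows "norm (contour_integral (rectpath a b) f) \<le> B * (2 * ((Re b - Re a) + (Im b - Im a)))"
proof -
  define c d where "c = Complex (Re b) (Im a)" and "d = Complex (Re a) (Im b)"
  have rect: "rectpath a b = linepath a c +++ linepath c b +++ linepath b d +++ linepath d a"
    by (simp add: rectpath_def Let_def c_def d_def)
  have img: "path_image (rectpath a b) = closed_segment a c \<union> closed_segment c b \<union> closed_segment b d \<union> closed_segment d a"
    unfolding rect by (simp add: path_image_join Un_assoc)
  have int: "f contour_integrable_on linepath u v" if "closed_segment u v \<subseteq> path_image (rectpath a b)" for u v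
    using continuous_on_subset[OF assms(1) that] by (rule contour_integrable_continuous_linepath)
  have bd: "norm (contour_integral (linepath u v) f) \<le> B * norm (v - u)" if "closed_segment u v \<subseteq> path_image (rectpath a b)" for u v
    using int[OF that] assms(4,5) that by (intro contour_integral_bound_linepath) auto
  have seg: "closed_segment a c \<subseteq> path_image (rectpath a b)" "closed_segment c b \<subseteq> path_image (rectpath a b)"
    "closed_segment b d \<subseteq> path_image (rectpath a b)" "closed_segment d a \<subseteq> path_image (rectpath a b)"
    unfolding img by auto
  have "contour_integral (rectpath a b) f = contour_integral (linepath a c) f + (contour_integral (linepath c b) f
      + (contour_integral (linepath b d) f + contour_integral (linepath d a) f))"
    unfolding rect using int[OF seg(1)] int[OF seg(2)] int[OF seg(3)] int[OF seg(4)]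
    by (simp add: contour_integrable_joinI valid_path_join)
  also have "norm \<dots> \<le> B * norm (c - a) + (B * norm (b - c) + (B * norm (d - b) + B * norm (a - d)))"
    by (rule norm_triangle_mono bd[OF seg(1)] bd[OF seg(2)] bd[OF seg(3)] bd[OF seg(4)])+
  also have "\<dots> = B * (norm (c - a) + norm (b - c) + norm (d - b) + norm (a - d))"
    by (simp add: algebra_simps)
  also have "norm (c - a) + norm (b - c) + norm (d - b) + norm (a - d) = 2 * ((Re b - Re a) + (Im b - Im a))"
    using assms(2,3) by (simp add: c_def d_def cmod_eq_Re cmod_eq_Im)
  finally show ?thesis .
qed

text \<open>
  The contour integrals only give the limit of the sums over the roots in the squares. Together with
  summability, which makes every exhausting sequence of finite sets equivalent, this gives the
  unordered sum.
\<close>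

lemma partial_fractions_squares:
  fixes f :: "complex \<Rightarrow> complex" and S :: "'i \<Rightarrow> complex" and Y :: "nat \<Rightarrow> real"
  assumes f: "f holomorphic_on UNIV"
    and S: "bij_betw S UNIV {z. f z = 0}"
    and simple: "\<And>i. deriv f (S i) \<noteq> 0"
    and Y: "filterlim Y at_top sequentially" and c: "c > 0"
    and lower: "\<forall>\<^sub>F n in sequentially. \<forall>z. max \<bar>Re z\<bar> \<bar>Im z\<bar> = Y n \<longrightarrow> norm (f z) \<ge> c * Y n"
    and s: "f s \<noteq> 0"
    and summable: "(\<lambda>i. 1 / (deriv f (S i) * (s - S i))) summable_on UNIV"
  shows "((\<lambda>i. 1 / (deriv f (S i) * (s - S i))) has_sum (1 / f s)) UNIV"
proof -
  define q :: "complex \<Rightarrow> real" where "q z = max \<bar>Re z\<bar> \<bar>Im z\<bar>" for z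
  define t where "t i = 1 / (deriv f (S i) * (s - S i))" for i
  define F where "F z = 1 / (f z * (z - s))" for z
  define A where "A n = {i. q (S i) < Y n}" for n
  define sq where "sq n = rectpath (Complex (- Y n) (- Y n)) (Complex (Y n) (Y n))" for n
  have inj: "inj S" using S by (simp add: bij_betw_def)
  have zero: "f (S i) = 0" for i using S by (auto simp: bij_betw_def)
  have S_neq: "S i \<noteq> s" for i using zero[of i] s by auto
  note fin = finite_zeros_cball[OF f s]
  have fin_idx: "finite {i. norm (S i) \<le> R}" for R
  proof (rule finite_imageD)
    show "finite (S ` {i. norm (S i) \<le> R})"
      using zero by (intro finite_subset[OF _ fin[of R]]) auto
    show "inj_on S {i. norm (S i) \<le> R}"
      using inj by (rule inj_on_subset) simp
  qed
  have A_fin: "finite (A n)" for n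
  proof (rule finite_subset[OF _ fin_idx[of "2 * Y n"]])
    show "A n \<subseteq> {i. norm (S i) \<le> 2 * Y n}"
    proof
      fix i assume "i \<in> A n"
      thus "i \<in> {i. norm (S i) \<le> 2 * Y n}"
        using cmod_le[of "S i"] by (simp add: A_def q_def)
    qed
  qed
  \<comment> \<open>The squares exhaust all roots, so the sums over them converge to the unordered sum.\<close>
  have "filterlim A (finite_subsets_at_top UNIV) sequentially"
    unfolding filterlim_finite_subsets_at_top
  proof safe
    fix X :: "'i set" assume X: "finite X"
    have "\<forall>\<^sub>F n in sequentially. q (S i) < Y n" for i
      using Y unfolding filterlim_at_top_dense by blast
    hence "\<forall>\<^sub>F n in sequentially. \<forall>i\<in>X. q (S i) < Y n"
      using X by (intro eventually_ball_finite) blast+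
    thus "\<forall>\<^sub>F n in sequentially. finite (A n) \<and> X \<subseteq> A n \<and> A n \<subseteq> UNIV"
      by eventually_elim (use A_fin in \<open>auto simp: A_def\<close>)
  qed
  moreover have "(t has_sum infsum t UNIV) UNIV"
    using summable by (simp add: t_def[abs_def])
  ultimately have lim: "(\<lambda>n. sum t (A n)) \<longlonglongrightarrow> infsum t UNIV"
    unfolding has_sum_def by (rule filterlim_compose[rotated])

  have ev: "\<forall>\<^sub>F n in sequentially. Y n > 2 * norm s + 1"
    using Y unfolding filterlim_at_top_dense by blast
  have main: "contour_integral (sq n) F = 2 * pi * \<i> * (1 / f s - sum t (A n)) \<and>
       norm (contour_integral (sq n) F) \<le> 16 / (c * Y n)"
    if n: "Y n > 2 * norm s + 1" "\<forall>z. q z = Y n \<longrightarrow> norm (f z) \<ge> c * Y n" for n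
  proof -
    have Y_pos: "Y n > 0" using n(1) norm_ge_zero[of s] by linarith
    have img: "path_image (sq n) = {z. q z = Y n}"
      unfolding sq_def using Y_pos by (subst path_image_rectpath) (auto simp: q_def)
    have norm_le: "q z \<le> norm z" for z :: complex
      using abs_Re_le_cmod abs_Im_le_cmod by (simp add: q_def)
    have box: "z \<in> box (Complex (- Y n) (- Y n)) (Complex (Y n) (Y n)) \<longleftrightarrow> q z < Y n" for z
      by (auto simp: in_box_complex_iff q_def)
    have cbox: "z \<in> cbox (Complex (- Y n) (- Y n)) (Complex (Y n) (Y n)) \<longleftrightarrow> q z \<le> Y n" for z
      by (auto simp: in_cbox_complex_iff q_def)
    have on_sq: "norm (f z) \<ge> c * Y n" "norm (z - s) \<ge> Y n / 2" "f z \<noteq> 0" "z \<noteq> s" if "z \<in> path_image (sq n)" for z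
    proof -
      show 1: "norm (f z) \<ge> c * Y n" using that n(2) by (simp add: img)
      have "norm z \<ge> Y n" using that norm_le[of z] by (simp add: img)
      thus 2: "norm (z - s) \<ge> Y n / 2" using n(1) norm_triangle_ineq2[of z s] norm_ge_zero[of s] by linarith
      have "c * Y n > 0" using c Y_pos by simp
      thus "f z \<noteq> 0" "z \<noteq> s" using 1 2 Y_pos by auto
    qed
    \<comment> \<open>A disc containing the square, on which the residue theorem is applied.\<close>
    define R where "R = 2 * Y n + 1"
    \<comment> \<open>Roots in the disc but outside the square have winding number \<open>0\<close>; none lies on the square.\<close>
    define pts where "pts = insert s {z. norm z \<le> R \<and> f z = 0}"
    have ball: "z \<in> ball 0 R" if "q z \<le> Y n" for z
      using that cmod_le[of z] by (simp add: R_def q_def)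
    have "contour_integral (sq n) F = 2 * pi * \<i> * (\<Sum>p\<in>pts. winding_number (sq n) p * residue F p)"
    proof (rule Residue_theorem)
      show "finite pts" using fin by (simp add: pts_def)
      show "F holomorphic_on ball 0 R - pts"
        unfolding F_def pts_def using holomorphic_on_subset[OF f]
        by (auto intro!: holomorphic_intros)
      show "path_image (sq n) \<subseteq> ball 0 R - pts"
      proof
        fix z assume z: "z \<in> path_image (sq n)"
        hence "z \<in> ball 0 R" by (intro ball) (simp add: img)
        moreover have "z \<notin> pts" using on_sq[OF z] by (simp add: pts_def)
        ultimately show "z \<in> ball 0 R - pts" by blast
      qed
      show "\<forall>z. z \<notin> ball 0 R \<longrightarrow> winding_number (sq n) z = 0"
      proof (intro allI impI)
        fix z :: complex assume "z \<notin> ball 0 R"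
        hence "\<not> q z \<le> Y n" using ball by blast
        thus "winding_number (sq n) z = 0"
          unfolding sq_def using Y_pos by (intro winding_number_rectpath_outside) (auto simp: cbox)
      qed
    qed (auto simp: sq_def)
    also have "(\<Sum>p\<in>pts. winding_number (sq n) p * residue F p) = (\<Sum>p\<in>insert s (S ` A n). residue F p)"
    proof (rule sum.mono_neutral_cong_right)
      show "finite pts" using fin by (simp add: pts_def)
      show "insert s (S ` A n) \<subseteq> pts"
      proof
        fix p assume "p \<in> insert s (S ` A n)"
        thus "p \<in> pts"
          using zero ball[of p] by (auto simp: A_def pts_def)
      qed
      show "\<forall>p\<in>pts - insert s (S ` A n). winding_number (sq n) p * residue F p = 0"
      proof
        fix p assume "p \<in> pts - insert s (S ` A n)"
        hence p: "p \<in> pts" "p \<noteq> s" "p \<notin> S ` A n" by auto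
        from p(1,2) have "f p = 0" by (simp add: pts_def)
        then obtain i where i: "p = S i" using S by (auto simp: bij_betw_def)
        have "\<not> q p < Y n" using p i by (auto simp: A_def)
        moreover have "p \<notin> path_image (sq n)" using on_sq(3) \<open>f p = 0\<close> by blast
        ultimately have "\<not> q p \<le> Y n" by (simp add: img)
        hence "winding_number (sq n) p = 0"
          unfolding sq_def using Y_pos by (intro winding_number_rectpath_outside) (auto simp: cbox)
        thus "winding_number (sq n) p * residue F p = 0" by simp
      qed
      fix p assume "p \<in> insert s (S ` A n)"
      hence "q p < Y n"
      proof
        assume "p = s"
        moreover have "q s < Y n" using n(1) norm_le[of s] norm_ge_zero[of s] by linarith
        ultimately show ?thesis by simp
      qed (auto simp: A_def)
      hence "winding_number (sq n) p = 1"
        unfolding sq_def by (intro winding_number_rectpath) (simp add: box)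
      thus "winding_number (sq n) p * residue F p = residue F p" by simp
    qed
    also have "\<dots> = residue F s + (\<Sum>i\<in>A n. residue F (S i))"
    proof -
      have "s \<notin> S ` A n" using S_neq by auto
      thus ?thesis using A_fin[of n] inj_on_subset[OF inj, of "A n"] by (simp add: sum.reindex)
    qed
    also have "(\<Sum>i\<in>A n. residue F (S i)) = - sum t (A n)"
      unfolding sum_negf[symmetric]
      by (rule sum.cong) (simp_all add: F_def[abs_def] t_def residue_at_simple_zero[OF f zero simple S_neq[symmetric]])
    also have "residue F s = 1 / f s"
    proof -
      have "open {z. f z \<noteq> 0}"
        using holomorphic_on_imp_continuous_on[OF f] by (intro open_Collect_neq continuous_on_const)
      hence "residue (\<lambda>z. 1 / f z / (z - s)) s = 1 / f s"
        using s holomorphic_on_subset[OF f]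
        by (intro residue_simple[of "{z. f z \<noteq> 0}"]) (auto intro!: holomorphic_intros)
      thus ?thesis by (simp add: F_def[abs_def])
    qed
    finally have 1: "contour_integral (sq n) F = 2 * pi * \<i> * (1 / f s - sum t (A n))" by simp
    have "norm (contour_integral (sq n) F) \<le> 1 / (c * Y n * (Y n / 2)) * (2 * ((Y n - (- Y n)) + (Y n - (- Y n))))"
    proof -
      have "continuous_on (path_image (sq n)) F"
        unfolding F_def using on_sq holomorphic_on_imp_continuous_on[OF holomorphic_on_subset[OF f]]
        by (auto intro!: continuous_intros)
      moreover have "norm (F z) \<le> 1 / (c * Y n * (Y n / 2))" if "z \<in> path_image (sq n)" for z
        unfolding F_def norm_divide norm_mult using on_sq[OF that] c Y_pos
        by (intro frac_le mult_mono) auto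
      ultimately show ?thesis
        using contour_integral_rectpath_bound[of "Complex (- Y n) (- Y n)" "Complex (Y n) (Y n)" F "1 / (c * Y n * (Y n / 2))"] c Y_pos
        by (simp add: sq_def)
    qed
    also have "\<dots> = 16 / (c * Y n)" using c Y_pos by (simp add: field_simps)
    finally show ?thesis using 1 by simp
  qed
  have "(\<lambda>n. 1 / f s - sum t (A n)) \<longlonglongrightarrow> 0"
  proof (rule Lim_null_comparison)
    show "\<forall>\<^sub>F n in sequentially. norm (1 / f s - sum t (A n)) \<le> 16 / (c * Y n)"
      using ev lower[folded q_def]
    proof eventually_elim
      case (elim n)
      have "norm (1 / f s - sum t (A n)) \<le> 2 * pi * norm (1 / f s - sum t (A n))"
        using pi_ge_two by (intro mult_right_mono[of 1 "2 * pi", simplified]) auto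
      also have "\<dots> = norm (contour_integral (sq n) F)"
        using main[OF elim] by (simp add: norm_mult)
      also have "\<dots> \<le> 16 / (c * Y n)" using main[OF elim] by blast
      finally show ?case .
    qed
    show "(\<lambda>n. 16 / (c * Y n)) \<longlonglongrightarrow> 0"
      by (intro tendsto_divide_0[OF tendsto_const] filterlim_at_top_imp_at_infinity
          filterlim_tendsto_pos_mult_at_top[OF tendsto_const c Y])
  qed
  hence "(\<lambda>n. 1 / f s - (1 / f s - sum t (A n))) \<longlonglongrightarrow> 1 / f s - 0"
    by (intro tendsto_diff tendsto_const)
  hence "infsum t UNIV = 1 / f s"
    using lim by (simp add: LIMSEQ_unique)
  thus ?thesis using \<open>(t has_sum infsum t UNIV) UNIV\<close> by (simp add: t_def[abs_def])
qed

section \<open>The characteristic function of a delay equation\<close>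

lemma summable_on_int_inverse_square: "(\<lambda>k. 1 / (1 + \<bar>real_of_int k\<bar>)\<^sup>2) summable_on UNIV"
proof -
  have "summable (\<lambda>n. 1 / (1 + real n)\<^sup>2)"
    using iffD2[OF summable_Suc_iff inverse_power_summable[of 2, where ?'a = real]]
    by (simp add: inverse_eq_divide add.commute)
  hence nat: "(\<lambda>n. 1 / (1 + real n)\<^sup>2) summable_on UNIV"
    by (intro norm_summable_imp_summable_on) simp
  have "(\<lambda>k. 1 / (1 + \<bar>real_of_int k\<bar>)\<^sup>2) summable_on range f"
    if "inj f" "\<And>n. \<bar>f n\<bar> = int n" for f :: "nat \<Rightarrow> int"
  proof -
    have "\<bar>real_of_int (f n)\<bar> = real n" for n
      using that(2)[of n] by (metis of_int_abs of_int_of_nat_eq)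
    thus ?thesis using nat that(1) by (simp add: summable_on_reindex o_def)
  qed
  from this[of int] this[of "\<lambda>n. - int n"]
  have "(\<lambda>k. 1 / (1 + \<bar>real_of_int k\<bar>)\<^sup>2) summable_on range int \<union> range (\<lambda>n. - int n)"
    by (intro summable_on_union) (auto simp: inj_def)
  also have "range int \<union> range (\<lambda>n. - int n) = UNIV"
  proof -
    have "k \<in> range int \<union> range (\<lambda>n. - int n)" for k by (cases k rule: int_cases2) auto
    thus ?thesis by blast
  qed
  finally show ?thesis .
qed

text \<open>
  Here \<open>M\<close> is the largest index with a nonzero coefficient. The zero coefficients beyond it
  disappear from all sums, so its exponential dominates as \<open>Re s \<rightarrow> - \<infinity>\<close>.
\<close>

locale delay_quasipolynomial =
  fixes N M :: nat and a h :: real and ad :: "nat \<Rightarrow> real"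
  assumes h: "h > 0" and M: "M \<in> {1..N}" "ad M \<noteq> 0"
    and M_max: "\<And>j. j \<in> {1..N} \<Longrightarrow> ad j \<noteq> 0 \<Longrightarrow> j \<le> M"
begin

text \<open>
  The lower-order exponentials relative to the leading one, see \<open>\<Delta>_eq\<close>: they are exponentially
  small as \<open>Re s \<rightarrow> - \<infinity>\<close>, with total weight \<open>B\<close>. The sum is empty if \<open>M = 1\<close>.
\<close>

definition E :: "complex \<Rightarrow> complex" where
  "E s = (\<Sum>j=1..<M. of_real (ad j / ad M) * exp (of_real (real (M - j) * h) * s))"

definition E' :: "complex \<Rightarrow> complex" where
  "E' s = (\<Sum>j=1..<M. of_real (ad j / ad M) * (of_real (real (M - j) * h) * exp (of_real (real (M - j) * h) * s)))"

definition B :: real where "B = (\<Sum>j=1..<M. \<bar>ad j / ad M\<bar>)"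

abbreviation \<Delta> :: "complex \<Rightarrow> complex" where "\<Delta> \<equiv> char_fun N a ad h"

definition \<Delta>' :: "complex \<Rightarrow> complex" where
  "\<Delta>' s = 1 + (\<Sum>j=1..N. of_nat j * of_real (ad j) * of_real h * exp (- of_nat j * s * of_real h))"

lemma deriv_mult_exp: "((\<lambda>s. c * exp (k * s)) has_field_derivative c * (k * exp (k * s))) (at s)" for c k s :: complex
  by (auto intro!: derivative_eq_intros)

lemma deriv_E: "(E has_field_derivative E' s) (at s)"
  unfolding E_def E'_def by (intro DERIV_sum deriv_mult_exp)

lemma deriv_\<Delta>: "(\<Delta> has_field_derivative \<Delta>' s) (at s)"
proof -
  have D: "((\<lambda>s. s - of_real a - (\<Sum>j=1..N. of_real (ad j) * exp (- (of_nat j * of_real h) * s)))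
     has_field_derivative 1 - 0 - (\<Sum>j=1..N. of_real (ad j) * (- (of_nat j * of_real h) * exp (- (of_nat j * of_real h) * s)))) (at s)"
    by (intro DERIV_diff DERIV_ident DERIV_const DERIV_sum deriv_mult_exp)
  have arg: "exp (- (of_nat j * of_real h) * z) = exp (- of_nat j * z * of_real h)" for j :: nat and z :: complex
    by (rule arg_cong[of _ _ exp]) simp
  have neg: "of_real (ad j) * (- (of_nat j * of_real h) * w) = - (of_nat j * of_real (ad j) * of_real h * w)"
    for j :: nat and w :: complex
    by simp
  have 1: "1 - 0 - (\<Sum>j=1..N. of_real (ad j) * (- (of_nat j * of_real h) * exp (- (of_nat j * of_real h) * s))) = \<Delta>' s"
    unfolding \<Delta>'_def neg arg sum_negf diff_zero diff_minus_eq_add by (rule refl)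
  have 2: "(\<lambda>s. s - of_real a - (\<Sum>j=1..N. of_real (ad j) * exp (- (of_nat j * of_real h) * s))) = \<Delta>"
    unfolding char_fun_def arg by (rule refl)
  show ?thesis using D unfolding 1 2 .
qed

lemma sum_upto_M:
  "(\<Sum>j=1..N. of_real (ad j) * f j) = of_real (ad M) * f M + (\<Sum>j=1..<M. of_real (ad j) * (f j :: complex))"
proof -
  have "(\<Sum>j=1..N. of_real (ad j) * f j) = (\<Sum>j\<in>insert M {1..<M}. of_real (ad j) * f j)"
  proof (rule sum.mono_neutral_right)
    have "ad j = 0" if "j \<in> {1..N}" "j \<notin> insert M {1..<M}" for j
      using that M_max[of j] by (cases "ad j = 0") auto
    thus "\<forall>j\<in>{1..N} - insert M {1..<M}. of_real (ad j) * f j = 0" by simp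
  qed (use M(1) in auto)
  thus ?thesis by simp
qed

lemma exp_split:
  fixes s :: complex
  assumes "j \<in> {1..<M}"
  shows "exp (- of_nat j * s * of_real h) = exp (- of_nat M * s * of_real h) * exp (of_real (real (M - j) * h) * s)"
proof -
  have "- of_nat j * s * of_real h = - of_nat M * s * of_real h + of_real (real (M - j) * h) * s"
    using assms by (simp add: of_nat_diff algebra_simps)
  thus ?thesis by (simp only: exp_add)
qed

lemma \<Delta>_eq: "\<Delta> s = s - of_real a - of_real (ad M) * exp (- of_nat M * s * of_real h) * (1 + E s)"
proof -
  have "(\<Sum>j=1..<M. of_real (ad j) * exp (- of_nat j * s * of_real h)) =
        of_real (ad M) * exp (- of_nat M * s * of_real h) * E s"
    unfolding E_def sum_distrib_left using M(2) by (intro sum.cong refl) (simp only: exp_split, simp)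
  thus ?thesis
    unfolding char_fun_def sum_upto_M by (simp only: distrib_left mult_1_right)
qed

lemma \<Delta>'_eq: "\<Delta>' s = 1 + of_real (ad M) * exp (- of_nat M * s * of_real h) * (of_real (real M * h) * (1 + E s) - E' s)"
proof -
  have eq: "of_nat j * of_real (ad j) * of_real h * exp (- of_nat j * s * of_real h)
    = of_real (ad j) * (of_real (real j * h) * exp (- of_nat j * s * of_real h))" for j
    by (simp only: of_real_mult of_real_of_nat_eq mult_ac)
  have "(\<Sum>j=1..<M. of_real (ad j) * (of_real (real j * h) * exp (- of_nat j * s * of_real h))) =
        of_real (ad M) * exp (- of_nat M * s * of_real h) * (of_real (real M * h) * E s - E' s)"
    unfolding E_def E'_def sum_distrib_left sum_subtractf[symmetric]
  proof (rule sum.cong[OF refl])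
    fix j assume j: "j \<in> {1..<M}"
    define x where "x = exp (of_real (real (M - j) * h) * s)"
    define y where "y = exp (- of_nat M * s * of_real h)"
    have 1: "complex_of_real (real j * h) = of_real (real M * h) - of_real (real (M - j) * h)"
      using j by (simp add: of_nat_diff algebra_simps)
    have 2: "complex_of_real (ad j) = of_real (ad M) * of_real (ad j / ad M)"
      using M(2) by simp
    show "of_real (ad j) * (of_real (real j * h) * exp (- of_nat j * s * of_real h)) =
        of_real (ad M) * exp (- of_nat M * s * of_real h) *
          (of_real (real M * h) * (of_real (ad j / ad M) * exp (of_real (real (M - j) * h) * s)) -
           of_real (ad j / ad M) * (of_real (real (M - j) * h) * exp (of_real (real (M - j) * h) * s)))"
      unfolding exp_split[OF j] x_def[symmetric] y_def[symmetric] 1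
      by (subst 2) (simp only: algebra_simps)
  qed
  note sum = this
  have "p + (q * (r * y) + q * y * (r * e - e')) = p + q * y * (r * (1 + e) - e')" for p q r y e e' :: complex
    by (simp add: algebra_simps)
  thus ?thesis
    unfolding \<Delta>'_def eq sum_upto_M sum .
qed

lemma E_bounds:
  assumes "Re s \<le> 0"
  shows "norm (E s) \<le> B * exp (h * Re s)" "norm (E' s) \<le> real M * h * (B * exp (h * Re s))"
proof -
  have exp: "norm (exp (of_real (real (M - j) * h) * s)) \<le> exp (h * Re s)" if "j \<in> {1..<M}" for j
  proof -
    have "1 * (h * Re s) \<ge> real (M - j) * (h * Re s)"
      using that assms h by (intro mult_right_mono_neg mult_nonneg_nonpos) auto
    moreover have "Re (of_real (real (M - j) * h) * s) = real (M - j) * (h * Re s)"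
      by (simp only: times_complex.sel Re_complex_of_real Im_complex_of_real mult_zero_left diff_zero mult_ac)
    ultimately show ?thesis unfolding norm_exp_eq_Re exp_le_cancel_iff by linarith
  qed
  show "norm (E s) \<le> B * exp (h * Re s)"
    unfolding E_def B_def sum_distrib_right
    by (intro sum_norm_le, subst norm_mult, intro mult_mono exp) (auto simp: norm_divide)
  have "norm (of_real (ad j / ad M) * (of_real (real (M - j) * h) * exp (of_real (real (M - j) * h) * s)))
     \<le> real M * h * (\<bar>ad j / ad M\<bar> * exp (h * Re s))" if "j \<in> {1..<M}" for j
  proof -
    have "norm (of_real (ad j / ad M) * (of_real (real (M - j) * h) * exp (of_real (real (M - j) * h) * s)))
       = \<bar>ad j / ad M\<bar> * ((real (M - j) * h) * norm (exp (of_real (real (M - j) * h) * s)))"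
      using h by (simp add: norm_mult norm_divide)
    also have "\<dots> \<le> \<bar>ad j / ad M\<bar> * ((real M * h) * exp (h * Re s))"
      using h exp[OF that] by (intro mult_left_mono mult_mono) auto
    finally show ?thesis by (simp only: mult_ac)
  qed
  thus "norm (E' s) \<le> real M * h * (B * exp (h * Re s))"
    unfolding E'_def B_def sum_distrib_right sum_distrib_left by (intro sum_norm_le)
qed

text \<open>
  Beyond \<open>X\<close> to the left the following hold: the lower-order terms are at most an eighth of the leading
  one; \<open>1 / (s - a)\<close> is at most \<open>M h / 4\<close>, a quarter of the main term of \<open>\<phi>'\<close>; and the leading
  exponential, halved, exceeds \<open>\<bar>s\<bar> + \<bar>a\<bar> + t\<close> whenever \<open>\<bar>Im s\<bar> \<le> t = - Re s\<close>, as then \<open>\<bar>s\<bar> \<le> 2 t\<close>.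
\<close>

lemma threshold_exists:
  "\<exists>X>0. \<forall>t\<ge>X. B * exp (- (h * t)) \<le> 1 / 8 \<and> t \<ge> \<bar>a\<bar> + 4 / (real M * h)
           \<and> 3 * t + \<bar>a\<bar> < \<bar>ad M\<bar> * exp (real M * h * t) / 2"
proof -
  have pos: "real M * h > 0" "\<bar>ad M\<bar> > 0" using M h by auto
  have "((\<lambda>t. B * exp (- (h * t))) \<longlongrightarrow> B * 0) at_top"
    by (intro tendsto_mult tendsto_const) (use h in real_asymp)
  hence 1: "\<forall>\<^sub>F t in at_top. B * exp (- (h * t)) < 1 / 8"
    by (rule order_tendstoD) simp
  have 2: "\<forall>\<^sub>F t in at_top. t \<ge> \<bar>a\<bar> + 4 / (real M * h)"
    by (rule eventually_ge_at_top)
  have "\<forall>\<^sub>F t in at_top. 3 * t + A < c * exp (b * t) / 2" if "b > 0" "c > 0" for A b c :: real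
    using that by real_asymp
  from this[OF pos] have 3: "\<forall>\<^sub>F t in at_top. 3 * t + \<bar>a\<bar> < \<bar>ad M\<bar> * exp (real M * h * t) / 2" .
  from eventually_conj[OF 1 eventually_conj[OF 2 3]]
  obtain X where "\<forall>t\<ge>X. B * exp (- (h * t)) < 1 / 8 \<and> t \<ge> \<bar>a\<bar> + 4 / (real M * h)
           \<and> 3 * t + \<bar>a\<bar> < \<bar>ad M\<bar> * exp (real M * h * t) / 2"
    unfolding eventually_at_top_linorder by blast
  thus ?thesis by (intro exI[of _ "max X 1"]) (auto intro: less_imp_le)
qed

end

locale delay_threshold = delay_quasipolynomial +
  fixes X :: real
  assumes X_pos: "X > 0"
    and X_E: "\<And>t. t \<ge> X \<Longrightarrow> B * exp (- (h * t)) \<le> 1 / 8"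
    and X_a: "X \<ge> \<bar>a\<bar> + 4 / (real M * h)"
    and X_exp: "\<And>t. t \<ge> X \<Longrightarrow> 3 * t + \<bar>a\<bar> < \<bar>ad M\<bar> * exp (real M * h * t) / 2"
begin

lemma Mh_pos: "real M * h > 0" using M h by auto

lemma far_bounds:
  assumes "Re s \<le> - X"
  shows "norm (E s) \<le> 1 / 8" "norm (E' s) \<le> real M * h / 8"
    "norm (s - of_real a) \<ge> 4 / (real M * h)" "Re (s - of_real a) < 0"
proof -
  have "B * exp (h * Re s) \<le> 1 / 8" using X_E[of "- Re s"] assms by simp
  thus "norm (E s) \<le> 1 / 8" using E_bounds(1)[of s] assms X_pos by linarith
  have "real M * h * (B * exp (h * Re s)) \<le> real M * h * (1 / 8)"
    using \<open>B * exp (h * Re s) \<le> 1 / 8\<close> Mh_pos by (intro mult_left_mono) auto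
  thus "norm (E' s) \<le> real M * h / 8" using E_bounds(2)[of s] assms X_pos by linarith
  have "4 / (real M * h) > 0" using Mh_pos by simp
  moreover have "Re (s - of_real a) \<le> - (4 / (real M * h))" using assms X_a by simp
  ultimately show "norm (s - of_real a) \<ge> 4 / (real M * h)" "Re (s - of_real a) < 0"
    using abs_Re_le_cmod[of "s - of_real a"] by linarith+
qed

lemma one_plus_E_bounds:
  assumes "Re s \<le> - X"
  shows "Re (1 + E s) \<ge> 1 / 2" "norm (1 + E s) \<ge> 1 / 2"
proof -
  show "Re (1 + E s) \<ge> 1 / 2" using far_bounds(1)[OF assms] abs_Re_le_cmod[of "E s"] by simp
  thus "norm (1 + E s) \<ge> 1 / 2" using complex_Re_le_cmod[of "1 + E s"] by linarith
qed

text \<open>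
  Here the leading exponential dominates. As \<open>0\<close> is an admissible imaginary part, there are no real
  roots to the left of \<open>- X\<close>.
\<close>

lemma \<Delta>_lower_left:
  assumes "Re s \<le> - X" "\<bar>Im s\<bar> \<le> - Re s"
  shows "norm (\<Delta> s) \<ge> - Re s"
proof -
  define L where "L = of_real (ad M) * exp (- of_nat M * s * of_real h) * (1 + E s)"
  have "norm L = \<bar>ad M\<bar> * exp (real M * h * (- Re s)) * norm (1 + E s)"
    unfolding L_def norm_mult norm_exp_eq_Re by (simp add: mult_ac)
  also have "\<dots> \<ge> \<bar>ad M\<bar> * exp (real M * h * (- Re s)) * (1 / 2)"
    by (intro mult_left_mono one_plus_E_bounds assms) auto
  finally have "norm L > 3 * (- Re s) + \<bar>a\<bar>" using X_exp[of "- Re s"] assms by simp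
  moreover have "norm s \<le> 2 * (- Re s)" using cmod_le[of s] assms X_pos by linarith
  moreover have "norm L \<le> norm (\<Delta> s) + norm s + \<bar>a\<bar>"
  proof -
    have "L = s - of_real a - \<Delta> s" unfolding \<Delta>_eq L_def by simp
    thus ?thesis
      using norm_triangle_ineq4[of "s - of_real a" "\<Delta> s"] norm_triangle_ineq4[of s "of_real a"] by simp
  qed
  ultimately show ?thesis by linarith
qed

definition K :: real where "K = \<bar>a\<bar> + (\<Sum>j=1..N. \<bar>ad j\<bar> * exp (real j * h * X))"

text \<open>
  The exponentials are bounded by \<open>K\<close> here, so \<open>s\<close> dominates. In particular only finitely many roots lie to the
  right of \<open>- X\<close>.
\<close>

lemma \<Delta>_lower_right:
  assumes "Re s \<ge> - X"
  shows "norm (\<Delta> s) \<ge> norm s - K"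
proof -
  have "norm (\<Sum>j=1..N. of_real (ad j) * exp (- of_nat j * s * of_real h)) \<le> (\<Sum>j=1..N. \<bar>ad j\<bar> * exp (real j * h * X))"
  proof (rule sum_norm_le)
    fix j
    have "real j * h * (- Re s) \<le> real j * h * X"
      using assms h by (intro mult_left_mono) auto
    thus "norm (of_real (ad j) * exp (- of_nat j * s * of_real h)) \<le> \<bar>ad j\<bar> * exp (real j * h * X)"
      unfolding norm_mult norm_exp_eq_Re by (intro mult_mono) (auto simp: mult_ac)
  qed
  moreover define w where "w = (\<Sum>j=1..N. of_real (ad j) * exp (- of_nat j * s * of_real h))"
  ultimately have "norm w \<le> (\<Sum>j=1..N. \<bar>ad j\<bar> * exp (real j * h * X))" by simp
  moreover have "norm s \<le> norm (s - of_real a - w) + norm (of_real a :: complex) + norm w"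
    using norm_triangle_ineq[of "s - of_real a - w" "of_real a + w"] norm_triangle_ineq[of "of_real a" w] by simp
  moreover have "\<Delta> s = s - of_real a - w" by (simp add: char_fun_def w_def)
  ultimately show ?thesis by (simp add: K_def)
qed

text \<open>
  With \<open>\<sigma>\<close> the sign of \<open>Im s\<close>, the hypothesis on the phase makes the leading exponential
  \<open>- \<i> \<sigma> r\<close> for some \<open>r > 0\<close>. Subtracting it, even with the relative perturbation \<open>E\<close>, moves the imaginary
  part further away from \<open>0\<close>, and \<open>a\<close> is real.
\<close>

lemma \<Delta>_lower_horizontal:
  assumes "Re s \<le> - X" and \<sigma>: "\<sigma>\<^sup>2 = 1" "\<sigma> * Im s \<ge> 0"
    and cis: "of_real (ad M) * cis (- (real M * h * Im s)) = - \<i> * of_real (\<sigma> * \<bar>ad M\<bar>)"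
  shows "norm (\<Delta> s) \<ge> \<bar>Im s\<bar>"
proof -
  define r where "r = \<bar>ad M\<bar> * exp (real M * h * (- Re s))"
  have "exp (- of_nat M * s * of_real h) = of_real (exp (real M * h * (- Re s))) * cis (- (real M * h * Im s))"
    unfolding exp_eq_polar by (simp add: mult_ac)
  hence "of_real (ad M) * exp (- of_nat M * s * of_real h) = of_real (exp (real M * h * (- Re s))) * (of_real (ad M) * cis (- (real M * h * Im s)))"
    by (simp only: mult_ac)
  also have "\<dots> = - \<i> * of_real (\<sigma> * r)"
    unfolding cis r_def by simp
  finally have "\<Delta> s = s - of_real a - (- \<i> * of_real (\<sigma> * r)) * (1 + E s)" by (simp only: \<Delta>_eq)
  hence "Im (\<Delta> s) = Im s + \<sigma> * r * Re (1 + E s)" by simp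
  hence "\<sigma> * Im (\<Delta> s) = \<sigma> * Im s + \<sigma>\<^sup>2 * (r * Re (1 + E s))" by (simp only: algebra_simps power2_eq_square)
  also have "\<dots> \<ge> \<sigma> * Im s"
    using one_plus_E_bounds(1)[OF assms(1)] \<sigma>(1) by (simp add: r_def)
  finally have "\<sigma> * Im s \<le> \<bar>\<sigma>\<bar> * \<bar>Im (\<Delta> s)\<bar>" by (metis abs_ge_self abs_mult order_trans)
  moreover have "\<bar>\<sigma>\<bar> = 1" using \<sigma>(1) by (simp add: abs_square_eq_1)
  moreover have "\<sigma> * Im s = \<bar>Im s\<bar>" using \<sigma>(2) \<open>\<bar>\<sigma>\<bar> = 1\<close> by (metis abs_mult abs_of_nonneg mult_1)
  ultimately show ?thesis using abs_Im_le_cmod[of "\<Delta> s"] by simp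
qed

text \<open>
  The heights at which the phase condition of \<open>\<Delta>_lower_horizontal\<close> holds for both signs; the phase
  depends on the sign of the leading coefficient.
\<close>

definition Y :: "nat \<Rightarrow> real" where
  "Y n = ((if ad M > 0 then pi / 2 else 3 * pi / 2) + 2 * pi * real n) / (real M * h)"

lemma filterlim_Y: "filterlim Y at_top sequentially"
proof -
  have "filterlim (\<lambda>n. (c + 2 * pi * real n) / b) at_top sequentially" if "b > 0" for b c :: real
    using that by real_asymp
  thus ?thesis unfolding Y_def using Mh_pos by blast
qed

lemma cis_Y:
  assumes "\<sigma> = 1 \<or> \<sigma> = -1"
  shows "of_real (ad M) * cis (- (real M * h * (\<sigma> * Y n))) = - \<i> * of_real (\<sigma> * \<bar>ad M\<bar>)"
proof -
  define \<theta> where "\<theta> = (if ad M > 0 then pi / 2 else 3 * pi / 2) + 2 * pi * real n"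
  have "real M * h * Y n = \<theta>"
    using Mh_pos by (simp only: Y_def \<theta>_def times_divide_eq_right nonzero_mult_div_cancel_left less_irrefl)
  hence arg: "real M * h * (\<sigma> * Y n) = \<sigma> * \<theta>" by (simp only: mult_ac)
  have "cos \<theta> = 0" "ad M * sin \<theta> = \<bar>ad M\<bar>"
    using sin_2npi[of n] cos_2npi[of n] sin_3over2_pi cos_3over2_pi
    by (auto simp: \<theta>_def sin_add cos_add mult_ac)
  thus ?thesis
    unfolding arg using assms by (elim disjE) (auto simp: complex_eq_iff)
qed

text \<open>
  The left side of the square is far to the left once \<open>Y n \<ge> X\<close>; the parts of the boundary with
  \<open>Re z \<ge> - X\<close> are far from the origin; the rest lies on the horizontal sides.
\<close>

lemma \<Delta>_lower_squares:
  "\<forall>\<^sub>F n in sequentially. \<forall>z. max \<bar>Re z\<bar> \<bar>Im z\<bar> = Y n \<longrightarrow> norm (\<Delta> z) \<ge> 1 / 2 * Y n"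
proof -
  have "\<forall>\<^sub>F n in sequentially. Y n > max X (2 * K)"
    using filterlim_Y unfolding filterlim_at_top_dense by blast
  thus ?thesis
  proof eventually_elim
    case (elim n)
    hence n: "Y n > X" "Y n > 2 * K" by auto
    show ?case
    proof (intro allI impI)
      fix z assume z: "max \<bar>Re z\<bar> \<bar>Im z\<bar> = Y n"
      consider "Re z \<ge> - X" | "Re z \<le> - X" "\<bar>Im z\<bar> = Y n" | "Re z \<le> - X" "\<bar>Re z\<bar> = Y n" "\<bar>Im z\<bar> \<le> Y n"
        using z by linarith
      thus "norm (\<Delta> z) \<ge> 1 / 2 * Y n"
      proof cases
        case 1
        have "norm z \<ge> Y n" using z abs_Re_le_cmod[of z] abs_Im_le_cmod[of z] by linarith
        thus ?thesis using \<Delta>_lower_right[OF 1] n by linarith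
      next
        case 2
        define \<sigma> :: real where "\<sigma> = (if Im z \<ge> 0 then 1 else - 1)"
        have "Im z = \<sigma> * Y n" "\<sigma> = 1 \<or> \<sigma> = -1" "\<sigma> * Im z \<ge> 0" using 2 by (auto simp: \<sigma>_def)
        hence "norm (\<Delta> z) \<ge> \<bar>Im z\<bar>"
          using 2 cis_Y[of \<sigma> n] by (intro \<Delta>_lower_horizontal[of z \<sigma>]) auto
        thus ?thesis using 2 n X_pos by linarith
      next
        case 3
        thus ?thesis using \<Delta>_lower_left[of z] n X_pos by linarith
      qed
    qed
  qed
qed

text \<open>
  Dividing \<open>s - a = a\<^sub>M exp (- M h s) (1 + E s)\<close> by the factors other than \<open>a\<^sub>M\<close> and taking logarithms
  turns the equation for the roots into \<open>exp (\<phi> s) = a\<^sub>M\<close>. Principal logarithms are analytic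
  here: \<open>1 + E s\<close> has positive real part and \<open>s\<close> is kept off the real axis.
\<close>

definition \<phi> :: "complex \<Rightarrow> complex" where
  "\<phi> s = of_real (real M * h) * s + Ln (s - of_real a) - Ln (1 + E s)"

definition \<phi>' :: "complex \<Rightarrow> complex" where
  "\<phi>' s = of_real (real M * h) + 1 / (s - of_real a) - E' s / (1 + E s)"

lemma deriv_\<phi>:
  assumes "Re s \<le> - X" "Im s \<noteq> 0"
  shows "(\<phi> has_field_derivative \<phi>' s) (at s)"
proof -
  have "1 + E s \<notin> \<real>\<^sub>\<le>\<^sub>0" "s - of_real a \<notin> \<real>\<^sub>\<le>\<^sub>0"
    using one_plus_E_bounds(1)[OF assms(1)] assms(2) by (auto simp: complex_nonpos_Reals_iff)
  thus ?thesis
    unfolding \<phi>_def[abs_def] \<phi>'_def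
    by (auto intro!: derivative_eq_intros deriv_E simp: divide_inverse)
qed

text \<open>
  Each of the two corrections to the main term \<open>M h\<close> is at most \<open>M h / 4\<close>.
\<close>

lemma Re_\<phi>':
  assumes "Re s \<le> - X"
  shows "Re (\<phi>' s) \<ge> real M * h / 2"
proof -
  define u v where "u = 1 / (s - of_real a)" and "v = E' s / (1 + E s)"
  have "norm u \<le> 1 / (4 / (real M * h))"
    unfolding u_def norm_divide norm_one using far_bounds(3)[OF assms] Mh_pos by (intro frac_le) auto
  moreover have "norm v \<le> (real M * h / 8) / (1 / 2)"
    unfolding v_def norm_divide using far_bounds(2)[OF assms] one_plus_E_bounds(2)[OF assms] Mh_pos
    by (intro frac_le) auto
  ultimately have "\<bar>Re u\<bar> \<le> real M * h / 4" "\<bar>Re v\<bar> \<le> real M * h / 4"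
    using abs_Re_le_cmod[of u] abs_Re_le_cmod[of v] by (simp_all add: mult_ac)
  moreover have "Re (\<phi>' s) = real M * h + Re u - Re v"
    unfolding \<phi>'_def u_def[symmetric] v_def[symmetric] by simp
  ultimately show ?thesis by linarith
qed

lemma inj_on_\<phi>:
  assumes "convex U" "\<And>s. s \<in> U \<Longrightarrow> Re s \<le> - X \<and> Im s \<noteq> 0"
  shows "inj_on \<phi> U"
proof (rule inj_onI, rule ccontr)
  fix s t assume st: "s \<in> U" "t \<in> U" "\<phi> s = \<phi> t" "s \<noteq> t"
  have seg: "closed_segment s t \<subseteq> U" using st assms(1) by (simp add: closed_segment_subset)
  have "\<phi> s \<noteq> \<phi> t"
  proof (rule neq_if_deriv_in_half_plane[of s t \<phi> \<phi>' 1])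
    show "continuous_on (closed_segment s t) \<phi>"
      using seg assms(2) deriv_\<phi> by (intro continuous_at_imp_continuous_on) (blast intro: DERIV_isCont)
    fix z assume "z \<in> open_segment s t"
    hence "z \<in> U" using seg segment_open_subset_closed by blast
    thus "(\<phi> has_field_derivative \<phi>' z) (at z)" "Re (1 * \<phi>' z) > 0"
      using assms(2)[of z] deriv_\<phi>[of z] Re_\<phi>'[of z] Mh_pos by auto
  qed (use st in auto)
  thus False using st by simp
qed

text \<open>
  The last equation comes from \<open>\<Delta> = (s - a) (1 - a\<^sub>M exp (- \<phi>))\<close>, where the second factor
  vanishes at a root and has derivative \<open>\<phi>'\<close> there.
\<close>

lemma far_root:
  assumes "\<Delta> s = 0" "Re s \<le> - X"
  shows "Im s \<noteq> 0" "exp (\<phi> s) = of_real (ad M)" "\<Delta>' s = (s - of_real a) * \<phi>' s"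
proof -
  show "Im s \<noteq> 0" using \<Delta>_lower_left[OF assms(2)] assms X_pos by auto
  define y where "y = exp (- of_nat M * s * of_real h)"
  have y: "y \<noteq> 0" "exp (of_real (real M * h) * s) = inverse y"
    unfolding y_def by (simp_all add: exp_minus[symmetric] mult_ac)
  have nz: "1 + E s \<noteq> 0" "s - of_real a \<noteq> 0"
    using one_plus_E_bounds(2)[OF assms(2)] far_bounds(4)[OF assms(2)] by auto
  have root: "s - of_real a = of_real (ad M) * y * (1 + E s)"
    using assms(1) unfolding \<Delta>_eq y_def by simp
  show "exp (\<phi> s) = of_real (ad M)"
    unfolding \<phi>_def exp_diff exp_add y exp_Ln[OF nz(1)] exp_Ln[OF nz(2)]
    using nz(1) y(1) by (subst root) simp
  have "(s - of_real a) * \<phi>' s = (s - of_real a) * (of_real (real M * h) - E' s / (1 + E s)) + 1"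
    unfolding \<phi>'_def using nz(2) by (simp add: algebra_simps)
  also have "(s - of_real a) * (of_real (real M * h) - E' s / (1 + E s))
      = of_real (ad M) * y * (of_real (real M * h) * (1 + E s) - E' s)"
    unfolding root using nz(1) by (simp add: field_simps)
  finally show "\<Delta>' s = (s - of_real a) * \<phi>' s"
    unfolding \<Delta>'_eq y_def[symmetric] by simp
qed

text \<open>
  The root \<open>s\<close> is labelled by the integer \<open>k s\<close> with \<open>\<phi> s = Ln a\<^sub>M + 2 \<pi> \<i> (k s)\<close>. The labels are distinct
  because \<open>\<phi>\<close> is injective on \<open>U\<close>. The imaginary part of \<open>\<phi> s\<close> is \<open>M h (Im s)\<close> up to \<open>2 \<pi>\<close>, hence
  \<open>\<bar>k s\<bar>\<close> is at most of the order of \<open>\<bar>s - a\<bar>\<close>, and the sum is dominated by that of \<open>1 / (1 + \<bar>k\<bar>)\<^sup>2\<close>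
  over all integers.
\<close>

lemma summable_far_roots:
  assumes U: "convex U" "\<And>s. s \<in> U \<Longrightarrow> Re s \<le> - X \<and> Im s \<noteq> 0"
  shows "(\<lambda>s. 1 / (norm (s - of_real a))\<^sup>2) summable_on {s \<in> U. \<Delta> s = 0}"
proof -
  let ?Z = "{s \<in> U. \<Delta> s = 0}"
  have "\<exists>k::int. \<phi> s = Ln (of_real (ad M)) + of_int (2 * k) * pi * \<i>" if "s \<in> ?Z" for s
  proof -
    have "exp (\<phi> s) = exp (Ln (of_real (ad M)))"
      using far_root(2)[of s] U(2)[of s] that M(2) by (subst exp_Ln) auto
    thus ?thesis by (simp only: exp_eq)
  qed
  then obtain k :: "complex \<Rightarrow> int" where
    k: "\<And>s. s \<in> ?Z \<Longrightarrow> \<phi> s = Ln (of_real (ad M)) + of_int (2 * k s) * pi * \<i>" by metis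
  have "inj_on k ?Z"
  proof (rule inj_onI)
    fix s t assume st: "s \<in> ?Z" "t \<in> ?Z" "k s = k t"
    hence "\<phi> s = \<phi> t" using k[of s] k[of t] by simp
    thus "s = t" using st inj_onD[OF inj_on_\<phi>[OF U]] by blast
  qed
  moreover have "(\<lambda>k. 1 / (1 + \<bar>real_of_int k\<bar>)\<^sup>2) summable_on k ` ?Z"
    using summable_on_int_inverse_square by (rule summable_on_subset) auto
  ultimately have "(\<lambda>s. 1 / (1 + \<bar>real_of_int (k s)\<bar>)\<^sup>2) summable_on ?Z"
    by (simp add: summable_on_reindex o_def)
  hence "(\<lambda>s. (2 * (real M * h))\<^sup>2 * (1 / (1 + \<bar>real_of_int (k s)\<bar>)\<^sup>2)) summable_on ?Z"
    by (rule summable_on_cmult_right)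
  thus ?thesis
  proof (rule summable_on_comparison_test)
    fix s assume s: "s \<in> ?Z"
    define \<rho> where "\<rho> = norm (s - of_real a)"
    have \<rho>: "\<rho> \<ge> 4 / (real M * h)" using far_bounds(3)[of s] U(2)[of s] s by (simp add: \<rho>_def)
    hence Mh\<rho>: "real M * h * \<rho> \<ge> 4" using Mh_pos by (simp add: field_simps)
    have "\<rho> > 0" using \<rho> Mh_pos by (smt (verit) divide_pos_pos)
    have "Im (\<phi> s) = Im (Ln (of_real (ad M))) + 2 * pi * real_of_int (k s)"
      unfolding k[OF s] by simp
    moreover have "Im (\<phi> s) = real M * h * Im s + Im (Ln (s - of_real a)) - Im (Ln (1 + E s))"
      by (simp add: \<phi>_def)
    moreover have "\<bar>Im (Ln z)\<bar> \<le> pi" if "z \<noteq> 0" for z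
      using mpi_less_Im_Ln[OF that] Im_Ln_le_pi[OF that] by linarith
    moreover have "s - of_real a \<noteq> 0" "1 + E s \<noteq> 0"
      using one_plus_E_bounds(2)[of s] far_bounds(4)[of s] U(2)[of s] s by auto
    moreover have "\<bar>real M * h * Im s\<bar> \<le> real M * h * \<rho>"
      using abs_Im_le_cmod[of "s - of_real a"] h by (simp add: abs_mult \<rho>_def mult_left_mono)
    moreover have "complex_of_real (ad M) \<noteq> 0" using M(2) by simp
    ultimately have "\<bar>2 * pi * real_of_int (k s)\<bar> \<le> real M * h * \<rho> + 3 * pi"
      by (smt (verit))
    hence "2 * pi * \<bar>real_of_int (k s)\<bar> \<le> real M * h * \<rho> + 3 * pi"
      by (simp only: abs_mult abs_numeral abs_of_pos[OF pi_gt_zero])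
    moreover have "2 * pi * \<bar>real_of_int (k s)\<bar> \<ge> pi * (2 * \<bar>real_of_int (k s)\<bar>)" by simp
    moreover have "real M * h * \<rho> \<le> pi * (real M * h * \<rho>)"
      using Mh\<rho> pi_gt3 mult_right_mono[of 1 pi "real M * h * \<rho>"] by linarith
    ultimately have "pi * (2 * \<bar>real_of_int (k s)\<bar>) \<le> pi * (real M * h * \<rho> + 3)"
      by (simp add: algebra_simps)
    hence "2 * \<bar>real_of_int (k s)\<bar> \<le> real M * h * \<rho> + 3"
      using pi_gt_zero by (simp only: mult_le_cancel_left_pos)
    hence "1 + \<bar>real_of_int (k s)\<bar> \<le> 2 * (real M * h) * \<rho>" using Mh\<rho> by linarith
    hence "(1 + \<bar>real_of_int (k s)\<bar>)\<^sup>2 \<le> (2 * (real M * h))\<^sup>2 * \<rho>\<^sup>2"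
      unfolding power_mult_distrib[symmetric] by (intro power_mono) auto
    thus "1 / (norm (s - of_real a))\<^sup>2 \<le> (2 * (real M * h))\<^sup>2 * (1 / (1 + \<bar>real_of_int (k s)\<bar>)\<^sup>2)"
      unfolding \<rho>_def[symmetric] using \<open>\<rho> > 0\<close> by (simp add: field_simps)
  qed auto
qed

text \<open>
  Off a finite set, the roots lie in the two convex quadrants of \<open>Re s \<le> - X\<close> and are at least
  twice as far from \<open>a\<close> as \<open>s\<close> is. Then \<open>\<bar>s - r\<bar>\<close> and \<open>\<bar>\<Delta>' r\<bar>\<close> are both bounded below by multiples of
  \<open>\<bar>r - a\<bar>\<close>.
\<close>

lemma summable_roots:
  assumes "\<Delta> s \<noteq> 0"
  shows "(\<lambda>r. 1 / (\<Delta>' r * (s - r))) summable_on {r. \<Delta> r = 0}"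
proof -
  define Zf where "Zf = {r. \<Delta> r = 0 \<and> (Re r > - X \<or> norm (r - of_real a) < 2 * norm (s - of_real a))}"
  define U where "U \<sigma> = {r. Re r \<le> - X \<and> \<sigma> * Im r > 0}" for \<sigma> :: real
  define Z where "Z \<sigma> = {r \<in> U \<sigma>. \<Delta> r = 0} - Zf" for \<sigma>
  have holo: "\<Delta> holomorphic_on UNIV"
    using deriv_\<Delta> by (auto simp: holomorphic_on_def field_differentiable_def intro: has_field_derivative_at_within)
  have "finite Zf"
  proof (rule finite_subset[OF _ finite_zeros_cball[OF holo assms]])
    show "Zf \<subseteq> {r. norm r \<le> max K (2 * norm (s - of_real a) + \<bar>a\<bar>) \<and> \<Delta> r = 0}"
    proof
      fix r assume r: "r \<in> Zf"
      hence "norm r \<le> K \<or> norm (r - of_real a) < 2 * norm (s - of_real a)"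
        using \<Delta>_lower_right[of r] by (auto simp: Zf_def)
      moreover have "norm r \<le> norm (r - of_real a) + \<bar>a\<bar>"
        using norm_triangle_ineq[of "r - of_real a" "of_real a"] by simp
      ultimately have "norm r \<le> max K (2 * norm (s - of_real a) + \<bar>a\<bar>)" by auto
      thus "r \<in> {r. norm r \<le> max K (2 * norm (s - of_real a) + \<bar>a\<bar>) \<and> \<Delta> r = 0}"
        using r by (simp add: Zf_def)
    qed
  qed
  hence fin: "(\<lambda>r. 1 / (\<Delta>' r * (s - r))) summable_on Zf" by simp
  have half: "(\<lambda>r. 1 / (\<Delta>' r * (s - r))) summable_on Z \<sigma>" if "\<sigma> = 1 \<or> \<sigma> = -1" for \<sigma>
  proof -
    have "U \<sigma> = {r. Re r \<le> - X} \<inter> (if \<sigma> = 1 then {r. Im r > 0} else {r. Im r < 0})"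
      using that by (auto simp: U_def)
    hence "convex (U \<sigma>)"
      by (auto intro!: convex_Int simp: convex_halfspace_Re_le convex_halfspace_Im_gt convex_halfspace_Im_lt)
    hence "(\<lambda>r. 1 / (norm (r - of_real a))\<^sup>2) summable_on {r \<in> U \<sigma>. \<Delta> r = 0}"
      by (rule summable_far_roots) (auto simp: U_def)
    hence "(\<lambda>r. 1 / (norm (r - of_real a))\<^sup>2) summable_on Z \<sigma>"
      by (rule summable_on_subset) (auto simp: Z_def)
    hence "(\<lambda>r. 4 / (real M * h) * (1 / (norm (r - of_real a))\<^sup>2)) summable_on Z \<sigma>"
      by (rule summable_on_cmult_right)
    hence "(\<lambda>r. norm (1 / (\<Delta>' r * (s - r)))) summable_on Z \<sigma>"
    proof (rule summable_on_comparison_test)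
      fix r assume r: "r \<in> Z \<sigma>"
      hence *: "\<Delta> r = 0" "Re r \<le> - X" "norm (r - of_real a) \<ge> 2 * norm (s - of_real a)"
        by (auto simp: Z_def Zf_def U_def)
      define \<rho> where "\<rho> = norm (r - of_real a)"
      have "\<rho> > 0" using far_bounds(3)[OF *(2)] Mh_pos unfolding \<rho>_def by (smt (verit) divide_pos_pos)
      have "norm (\<Delta>' r) \<ge> \<rho> * (real M * h / 2)"
        unfolding far_root(3)[OF *(1,2)] norm_mult \<rho>_def
        using Re_\<phi>'[OF *(2)] complex_Re_le_cmod[of "\<phi>' r"] by (intro mult_left_mono) auto
      moreover have "norm (s - r) \<ge> \<rho> / 2"
        using norm_triangle_ineq2[of "r - of_real a" "s - of_real a"] *(3) by (simp add: \<rho>_def norm_minus_commute)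
      ultimately have "norm (\<Delta>' r * (s - r)) \<ge> (\<rho> * (real M * h / 2)) * (\<rho> / 2)"
        unfolding norm_mult using \<open>\<rho> > 0\<close> Mh_pos by (intro mult_mono) auto
      hence "norm (1 / (\<Delta>' r * (s - r))) \<le> 1 / ((\<rho> * (real M * h / 2)) * (\<rho> / 2))"
        unfolding norm_divide norm_one using \<open>\<rho> > 0\<close> Mh_pos
        by (intro frac_le mult_pos_pos) auto
      also have "\<dots> = 4 / (real M * h) * (1 / \<rho>\<^sup>2)" by (simp add: power2_eq_square)
      finally show "norm (1 / (\<Delta>' r * (s - r))) \<le> 4 / (real M * h) * (1 / (norm (r - of_real a))\<^sup>2)"
        by (simp only: \<rho>_def)
    qed auto
    thus ?thesis by (rule abs_summable_summable)
  qed
  have "{r. \<Delta> r = 0} = Zf \<union> (Z 1 \<union> Z (-1))"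
    using far_root(1) by (force simp: Zf_def Z_def U_def)
  thus ?thesis
    using fin half[of 1] half[of "-1"] by (auto intro: summable_on_union)
qed

end

theorem lemma3p3:
  fixes N :: nat and a h :: real and ad :: "nat \<Rightarrow> real" and S C :: "int \<Rightarrow> complex"
  assumes h: "h > 0"
    and ad: "\<exists>j\<in>{1..N}. ad j \<noteq> 0"
    and S: "bij_betw S UNIV {s. char_fun N a ad h s = 0}"
    and C_defined:
      "\<And>n. 1 + (\<Sum>j=1..N. of_nat j * of_real (ad j) * of_real h * exp (- of_nat j * S n * of_real h)) \<noteq> 0"
    and C:
      "\<And>n. C n = 1 / (1 + (\<Sum>j=1..N. of_nat j * of_real (ad j) * of_real h * exp (- of_nat j * S n * of_real h)))"
  shows "(\<forall>s. char_fun N a ad h s \<noteq> 0 \<longrightarrow>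
            ((\<lambda>n. C n / (s - S n)) has_sum (1 / char_fun N a ad h s)) UNIV)
       \<and> (\<forall>n. (\<exists>k. (S n - of_real a) * of_real h \<in> lambertW_range k)
            \<and> (\<forall>k. (S n - of_real a) * of_real h \<in> lambertW_range k \<longrightarrow>
                 S n = 1 / of_real h *
                   lambertW k (\<Sum>j=1..N. of_real (ad j) * of_real h * exp (- of_nat j * of_real a * of_real h)
                                 * exp (- (of_nat j - 1) * (S n - of_real a) * of_real h))
                   + of_real a))"
proof -
  define M where "M = Max {j \<in> {1..N}. ad j \<noteq> 0}"
  have "M \<in> {j \<in> {1..N}. ad j \<noteq> 0}"
    unfolding M_def using ad by (intro Max_in) auto
  moreover have "j \<le> M" if "j \<in> {1..N}" "ad j \<noteq> 0" for j
    unfolding M_def using that by (intro Max_ge) auto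
  ultimately interpret delay_quasipolynomial N M a h ad
    using h by unfold_locales auto
  obtain X where "X > 0" "\<forall>t\<ge>X. B * exp (- (h * t)) \<le> 1 / 8 \<and> t \<ge> \<bar>a\<bar> + 4 / (real M * h)
      \<and> 3 * t + \<bar>a\<bar> < \<bar>ad M\<bar> * exp (real M * h * t) / 2"
    using threshold_exists by blast
  then interpret delay_threshold N M a h ad X
    by unfold_locales auto
  have deriv: "deriv \<Delta> r = \<Delta>' r" for r using deriv_\<Delta> by (rule DERIV_imp_deriv)
  have holo: "\<Delta> holomorphic_on UNIV"
    using deriv_\<Delta> by (auto simp: holomorphic_on_def field_differentiable_def intro: has_field_derivative_at_within)
  have root: "\<Delta> (S n) = 0" for n using S by (auto simp: bij_betw_def)
  have "((\<lambda>n. C n / (s - S n)) has_sum (1 / \<Delta> s)) UNIV" if s: "\<Delta> s \<noteq> 0" for s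
  proof -
    have "(\<lambda>n. 1 / (deriv \<Delta> (S n) * (s - S n))) summable_on UNIV"
      unfolding deriv
      by (rule iffD2[OF summable_on_reindex_bij_betw[OF S, of "\<lambda>r. 1 / (\<Delta>' r * (s - r))"] summable_roots[OF s]])
    hence "((\<lambda>n. 1 / (deriv \<Delta> (S n) * (s - S n))) has_sum (1 / \<Delta> s)) UNIV"
      using C_defined deriv \<Delta>'_def
      by (intro partial_fractions_squares[OF holo S _ filterlim_Y _ \<Delta>_lower_squares s]) auto
    moreover have "1 / (deriv \<Delta> (S n) * (s - S n)) = C n / (s - S n)" for n
      unfolding C deriv \<Delta>'_def by simp
    ultimately show ?thesis by simp
  qed
  moreover have "S n = 1 / of_real h * lambertW k (\<Sum>j=1..N. of_real (ad j) * of_real h * exp (- of_nat j * of_real a * of_real h)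
         * exp (- (of_nat j - 1) * (S n - of_real a) * of_real h)) + of_real a"
    if k: "(S n - of_real a) * of_real h \<in> lambertW_range k" for n k
  proof -
    define w where "w = (S n - of_real a) * of_real h"
    \<comment> \<open>Both exponents equal \<open>- j S\<^sub>n h + w\<close>.\<close>
    have term_eq: "of_real (ad j) * exp (- of_nat j * S n * of_real h) * (of_real h * exp w) =
        of_real (ad j) * of_real h * exp (- of_nat j * of_real a * of_real h)
          * exp (- (of_nat j - 1) * (S n - of_real a) * of_real h)" for j
    proof -
      have "- of_nat j * S n * of_real h + w =
          - of_nat j * of_real a * of_real h + - (of_nat j - 1) * (S n - of_real a) * of_real h"
        unfolding w_def by (simp add: algebra_simps)
      hence "exp (- of_nat j * S n * of_real h) * exp w =
          exp (- of_nat j * of_real a * of_real h) * exp (- (of_nat j - 1) * (S n - of_real a) * of_real h)"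
        by (simp only: exp_add[symmetric])
      thus ?thesis by (simp only: mult_ac) 
    qed
    have "S n - of_real a = (\<Sum>j=1..N. of_real (ad j) * exp (- of_nat j * S n * of_real h))"
      using root[of n] by (simp add: char_fun_def)
    hence "w * exp w = (\<Sum>j=1..N. of_real (ad j) * exp (- of_nat j * S n * of_real h)) * (of_real h * exp w)"
      unfolding w_def by (simp only: mult.assoc)
    hence "lambertW k (\<Sum>j=1..N. of_real (ad j) * of_real h * exp (- of_nat j * of_real a * of_real h)
         * exp (- (of_nat j - 1) * (S n - of_real a) * of_real h)) = w"
      using k unfolding sum_distrib_right term_eq by (intro lambertW_eqI) (simp_all only: w_def)
    thus ?thesis using h by (simp only:) (simp add: w_def)
  qed
  ultimately show ?thesis using lambertW_range_exists by blast
qed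

end
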